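(* Suppose that for all $k\in\mathbb{N}$ the Levin-type sequence transformation $\mathcal{T}^{(k)}$ has a limiting transformation with characteristic polynomial $\mathring\Pi^{(k)}(z)=\sum_{j=0}^k\mathring\lambda^{(k)}_jz^j$, and that the sequence $\{\omega_n\}$ of nonzero elements of $\mathbb{K}$ satisfies $\omega_{n+1}/\omega_n\sim\rho\neq0$ for large $n$ with $\mathring\Pi^{(k)}(1/\rho)\neq0$ for all $k\in\mathbb{N}$. Then the transformation $\mathcal{T}$ is S-stable. If, additionally, the coefficients $\mathring\lambda^{(k)}_j$ of the characteristic polynomial alternate in sign, i.e. if $\mathring\lambda^{(k)}_j=(-1)^j|\mathring\lambda^{(k)}_j|/\tau_k$ with $|\tau_k|=1$, then the limits $\mathring{\boldsymbol\Gamma}^{(k)}(\mathcal{T})=\lim_{n\to\infty}\boldsymbol\Gamma^{(k)}_n(\mathcal{T})$ obey $$\mathring{\boldsymbol\Gamma}^{(k)}(\mathcal{T})=\tau_k\frac{\mathring\Pi^{(k)}(-1/|\rho|)}{|\mathring\Pi^{(k)}(1/\rho)|}.$$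
   Context: $\mathbb{K}$ denotes $\mathbb{R}$ or $\mathbb{C}$; $\mathbb{N}=\{1,2,\dots\}$, $\mathbb{N}_0=\mathbb{N}\cup\{0\}$. A coefficient set of order $k$ is a family $\lambda^{(k)}_{n,j}\in\mathbb{K}$ ($n\in\mathbb{N}_0$, $0\le j\le k$) with $\lambda^{(k)}_{n,k}\neq0$ for all $n$. The corresponding Levin-type sequence transformation of order $k$ maps a sequence $\{s_n\}$ in $\mathbb{K}$ and a sequence $\{\omega_n\}$ of nonzero elements of $\mathbb{K}$, with $\sum_{j=0}^k\lambda^{(k)}_{n,j}/\omega_{n+j}\neq0$, to $$\mathcal{T}^{(k)}_n=\frac{\sum_{j=0}^k\lambda^{(k)}_{n,j}\,s_{n+j}/\omega_{n+j}}{\sum_{j=0}^k\lambda^{(k)}_{n,j}/\omega_{n+j}}=\sum_{j=0}^k\gamma^{(k)}_{n,j}s_{n+j},\qquad\gamma^{(k)}_{n,j}=\frac{\lambda^{(k)}_{n,j}}{\omega_{n+j}}\left[\sum_{j'=0}^k\frac{\lambda^{(k)}_{n,j'}}{\omega_{n+j'}}\right]^{-1}.$$ $\mathcal{T}$ denotes the family of all $\mathcal{T}^{(k)}$, $k\in\mathbb{N}$. The stability indices (for the given $\{\omega_n\}$) are $\boldsymbol\Gamma^{(k)}_n(\mathcal{T})=\sum_{j=0}^k|\gamma^{(k)}_{n,j}|$. $\mathcal{T}$ is called S-stable if for every fixed $k$ the limit $\lim_{n\to\infty}\boldsymbol\Gamma^{(k)}_n(\mathcal{T})$ exists and is finite.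 A limiting transformation of $\mathcal{T}^{(k)}$ exists if the limits $\mathring\lambda^{(k)}_j=\lim_{n\to\infty}\lambda^{(k)}_{n,j}$ exist for all $0\le j\le k$ and $\mathring\lambda^{(k)}_k\neq0$; its characteristic polynomial is $\mathring\Pi^{(k)}(z)=\sum_{j=0}^k\mathring\lambda^{(k)}_jz^j$. The relation $\omega_{n+1}/\omega_n\sim\rho$ means $\omega_{n+1}/\omega_n\to\rho$. *)

theory Defs
  imports Complex_Main "HOL-Computational_Algebra.Polynomial"
begin

text \<open>
  The scalar field is a type of class \<open>real_normed_field\<close>; up to isometric isomorphism
  the only instances are the reals and the complex numbers.

  A coefficient set of order \<open>k\<close> is a function \<open>l\<close> with \<open>l n j\<close> the coefficient for
  \<open>0 \<le> j \<le> k\<close>; the values \<open>l n j\<close> with \<open>j > k\<close> are irrelevant. A family of coefficient sets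
  (and the family of transformations it determines) is a function \<open>lam\<close> such that \<open>lam k\<close>
  is the coefficient set of order \<open>k\<close>, where only \<open>k \<ge> 1\<close> matters.
\<close>

definition coefficient_set :: "nat \<Rightarrow> (nat \<Rightarrow> nat \<Rightarrow> 'a::real_normed_field) \<Rightarrow> bool" where
  "coefficient_set k l \<longleftrightarrow> (\<forall>n. l n k \<noteq> 0)"

definition levin_denom ::
    "nat \<Rightarrow> (nat \<Rightarrow> nat \<Rightarrow> 'a::real_normed_field) \<Rightarrow> (nat \<Rightarrow> 'a) \<Rightarrow> nat \<Rightarrow> 'a" where
  "levin_denom k l \<omega> n = (\<Sum>j\<le>k. l n j / \<omega> (n + j))"

definition levin_transform ::
    "nat \<Rightarrow> (nat \<Rightarrow> nat \<Rightarrow> 'a::real_normed_field) \<Rightarrow> (nat \<Rightarrow> 'a) \<Rightarrow> (nat \<Rightarrow> 'a) \<Rightarrow> nat \<Rightarrow> 'a" where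
  "levin_transform k l s \<omega> n =
     (\<Sum>j\<le>k. l n j * s (n + j) / \<omega> (n + j)) / levin_denom k l \<omega> n"

definition levin_weight ::
    "nat \<Rightarrow> (nat \<Rightarrow> nat \<Rightarrow> 'a::real_normed_field) \<Rightarrow> (nat \<Rightarrow> 'a) \<Rightarrow> nat \<Rightarrow> nat \<Rightarrow> 'a" where
  "levin_weight k l \<omega> n j = l n j / \<omega> (n + j) * inverse (levin_denom k l \<omega> n)"

lemma levin_transform_eq_weighted_sum:
  "levin_transform k l s \<omega> n = (\<Sum>j\<le>k. levin_weight k l \<omega> n j * s (n + j))"
  by (simp add: levin_transform_def levin_weight_def sum_divide_distrib field_simps)

definition stability_index ::
    "nat \<Rightarrow> (nat \<Rightarrow> nat \<Rightarrow> 'a::real_normed_field) \<Rightarrow> (nat \<Rightarrow> 'a) \<Rightarrow> nat \<Rightarrow> real" where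
  "stability_index k l \<omega> n = (\<Sum>j\<le>k. norm (levin_weight k l \<omega> n j))"

text \<open>
  The stability index at \<open>n\<close> is meaningful only if the denominator does not vanish there.
  Since division is total, the existence of the limit has to include that the indices are
  genuinely defined for all large \<open>n\<close>; if all denominators are nonzero, the first
  conjunct is trivially satisfied.
\<close>

definition S_stable ::
    "(nat \<Rightarrow> nat \<Rightarrow> nat \<Rightarrow> 'a::real_normed_field) \<Rightarrow> (nat \<Rightarrow> 'a) \<Rightarrow> bool" where
  "S_stable lam \<omega> \<longleftrightarrow>
     (\<forall>k\<ge>1. (\<forall>\<^sub>F n in sequentially. levin_denom k (lam k) \<omega> n \<noteq> 0) \<and>
            convergent (stability_index k (lam k) \<omega>))"

definition limiting_coeff :: "(nat \<Rightarrow> nat \<Rightarrow> 'a::real_normed_field) \<Rightarrow> nat \<Rightarrow> 'a" where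
  "limiting_coeff l j = lim (\<lambda>n. l n j)"

definition has_limiting_transformation ::
    "nat \<Rightarrow> (nat \<Rightarrow> nat \<Rightarrow> 'a::real_normed_field) \<Rightarrow> bool" where
  "has_limiting_transformation k l \<longleftrightarrow>
     (\<forall>j\<le>k. convergent (\<lambda>n. l n j)) \<and> limiting_coeff l k \<noteq> 0"

definition characteristic_poly ::
    "nat \<Rightarrow> (nat \<Rightarrow> nat \<Rightarrow> 'a::real_normed_field) \<Rightarrow> 'a poly" where
  "characteristic_poly k l = (\<Sum>j\<le>k. monom (limiting_coeff l j) j)"

definition limiting_stability_index ::
    "nat \<Rightarrow> (nat \<Rightarrow> nat \<Rightarrow> 'a::real_normed_field) \<Rightarrow> (nat \<Rightarrow> 'a) \<Rightarrow> real" where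
  "limiting_stability_index k l \<omega> = lim (stability_index k l \<omega>)"

end

(* Multiplying numerator and denominator of each weight by \<omega> n replaces 1 / \<omega> (n + j) by
   \<omega> n / \<omega> (n + j), which tends to (1 / \<rho>) ^ j. So the rescaled denominator tends to the
   characteristic polynomial at 1 / \<rho>, and every weight converges. For alternating limiting
   coefficients the limit of the norms of the rescaled numerators is, up to the factor \<tau>,
   the characteristic polynomial at - 1 / norm \<rho>. *)

theory Submission
  imports Defs
begin

text \<open>Telescoping: \<open>\<omega> n / \<omega> (n + Suc j)\<close> is
  \<open>\<omega> n / \<omega> (n + j)\<close> divided by the ratio of consecutive terms at
  \<open>n + j\<close>, which still tends to \<open>\<rho>\<close> because a shift does not affect
  the limit.\<close>

lemma shifted_quotient_tendsto:
  fixes \<omega> :: "nat \<Rightarrow> 'a::real_normed_field"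
  assumes nz: "\<And>n. \<omega> n \<noteq> 0"
    and lim: "(\<lambda>n. \<omega> (n + 1) / \<omega> n) \<longlonglongrightarrow> \<rho>" and "\<rho> \<noteq> 0"
  shows "(\<lambda>n. \<omega> n / \<omega> (n + j)) \<longlonglongrightarrow> (1 / \<rho>) ^ j"
proof (induction j)
  case 0
  then show ?case by (simp add: nz)
next
  case (Suc j)
  have "(\<lambda>n. \<omega> (n + j + 1) / \<omega> (n + j)) \<longlonglongrightarrow> \<rho>"
    using LIMSEQ_ignore_initial_segment[OF lim, of j] by simp
  from tendsto_divide[OF Suc this \<open>\<rho> \<noteq> 0\<close>] show ?case
    by (simp add: nz field_simps)
qed

lemma poly_characteristic_poly:
  "poly (characteristic_poly k l) z = (\<Sum>j\<le>k. limiting_coeff l j * z ^ j)"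
  by (simp add: characteristic_poly_def poly_sum poly_monom)

context
  fixes k :: nat and l :: "nat \<Rightarrow> nat \<Rightarrow> 'a::real_normed_field"
    and \<omega> :: "nat \<Rightarrow> 'a" and \<rho> :: 'a
  assumes limiting: "has_limiting_transformation k l"
    and nz: "\<And>n. \<omega> n \<noteq> 0"
    and ratio: "(\<lambda>n. \<omega> (n + 1) / \<omega> n) \<longlonglongrightarrow> \<rho>" and rho: "\<rho> \<noteq> 0"
begin

lemma rescaled_coeff_tendsto:
  assumes "j \<le> k"
  shows "(\<lambda>n. l n j * (\<omega> n / \<omega> (n + j))) \<longlonglongrightarrow> limiting_coeff l j * (1 / \<rho>) ^ j"
proof (rule tendsto_mult[OF _ shifted_quotient_tendsto[OF nz ratio rho]])
  show "(\<lambda>n. l n j) \<longlonglongrightarrow> limiting_coeff l j"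
    using limiting assms
    by (simp add: has_limiting_transformation_def limiting_coeff_def convergent_LIMSEQ_iff)
qed

lemma rescaled_denom_tendsto:
  "(\<lambda>n. levin_denom k l \<omega> n * \<omega> n) \<longlonglongrightarrow> poly (characteristic_poly k l) (1 / \<rho>)"
proof -
  have "(\<lambda>n. \<Sum>j\<le>k. l n j * (\<omega> n / \<omega> (n + j))) \<longlonglongrightarrow> poly (characteristic_poly k l) (1 / \<rho>)"
    unfolding poly_characteristic_poly by (intro tendsto_sum rescaled_coeff_tendsto) simp
  then show ?thesis
    by (simp add: levin_denom_def sum_distrib_right)
qed

context
  assumes char_nz: "poly (characteristic_poly k l) (1 / \<rho>) \<noteq> 0"
begin

text \<open>The rescaled denominator has a nonzero limit, so it is eventually nonzero, and then so
  is its factor \<open>levin_denom k l \<omega> n\<close>.\<close>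

lemma eventually_levin_denom_nonzero:
  "\<forall>\<^sub>F n in sequentially. levin_denom k l \<omega> n \<noteq> 0"
  using tendsto_imp_eventually_ne[OF rescaled_denom_tendsto char_nz]
  by (rule eventually_mono) auto

lemma stability_index_tendsto:
  "stability_index k l \<omega> \<longlonglongrightarrow>
     (\<Sum>j\<le>k. norm (limiting_coeff l j) * (1 / norm \<rho>) ^ j)
       / norm (poly (characteristic_poly k l) (1 / \<rho>))"
proof -
  \<comment> \<open>This holds for every \<open>n\<close>: where the denominator vanishes, both
    sides are 0 by the convention for division by zero.\<close>
  have weight: "levin_weight k l \<omega> n j = l n j * (\<omega> n / \<omega> (n + j)) / (levin_denom k l \<omega> n * \<omega> n)" for n j
    by (simp add: levin_weight_def nz field_simps)
  have "stability_index k l \<omega> \<longlonglongrightarrow>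
      (\<Sum>j\<le>k. norm (limiting_coeff l j * (1 / \<rho>) ^ j / poly (characteristic_poly k l) (1 / \<rho>)))"
    unfolding stability_index_def weight
    by (intro tendsto_sum tendsto_norm tendsto_divide rescaled_coeff_tendsto
        rescaled_denom_tendsto char_nz) simp
  then show ?thesis
    by (simp add: sum_divide_distrib norm_mult norm_divide norm_power)
qed

end

end

text \<open>At \<open>- x\<close> the sign of the coefficient cancels the sign of
  \<open>(- x) ^ j\<close>, so after multiplication by \<open>\<tau>\<close> every term is the image
  of a real number.\<close>

lemma alternating_characteristic_poly:
  fixes \<tau> :: "'a::real_normed_field"
  assumes "\<tau> \<noteq> 0"
    and alt: "\<And>j. j \<le> k \<Longrightarrow> limiting_coeff l j = (-1) ^ j * of_real (norm (limiting_coeff l j)) / \<tau>"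
  shows "\<tau> * poly (characteristic_poly k l) (of_real (- x)) =
    of_real (\<Sum>j\<le>k. norm (limiting_coeff l j) * x ^ j)"
proof -
  have "\<tau> * (limiting_coeff l j * of_real (- x) ^ j) = of_real (norm (limiting_coeff l j) * x ^ j)"
    if "j \<le> k" for j
  proof -
    have "\<tau> * limiting_coeff l j = (-1) ^ j * of_real (norm (limiting_coeff l j))"
      \<comment> \<open>The coefficient recurs inside the norm on the right of \<open>alt\<close>,
        so \<open>alt\<close> is applied once; as a rewrite rule it would loop.\<close>
      by (subst alt[OF that]) (simp add: \<open>\<tau> \<noteq> 0\<close>)
    then have "\<tau> * (limiting_coeff l j * of_real (- x) ^ j) =
        (-1) ^ j * of_real (norm (limiting_coeff l j)) * of_real (- x) ^ j"
      by (simp only: mult.assoc[symmetric])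
    \<comment> \<open>Both \<open>j\<close>-th powers merge into one, whose base is just
      \<open>of_real x\<close>.\<close>
    also have "\<dots> = of_real (norm (limiting_coeff l j)) * (- 1 * of_real (- x)) ^ j"
      by (simp only: power_mult_distrib mult.commute mult.left_commute)
    finally show ?thesis by simp
  qed
  then show ?thesis
    by (simp add: poly_characteristic_poly sum_distrib_left del: of_real_minus)
qed

text \<open>\<open>\<tau>\<close> ranges over the unit scalars of the field and may differ with
  \<open>k\<close>; the real limit is embedded by \<open>of_real\<close> so that both sides of the
  formula live in the field.\<close>

theorem theorem16:
  fixes lam :: "nat \<Rightarrow> nat \<Rightarrow> nat \<Rightarrow> 'a::real_normed_field"
    and \<omega> :: "nat \<Rightarrow> 'a" and \<rho> :: 'a
  assumes "\<And>k. k \<ge> 1 \<Longrightarrow> coefficient_set k (lam k)"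
    and "\<And>k. k \<ge> 1 \<Longrightarrow> has_limiting_transformation k (lam k)"
    and "\<And>n. \<omega> n \<noteq> 0"
    and "(\<lambda>n. \<omega> (n + 1) / \<omega> n) \<longlonglongrightarrow> \<rho>"
    and "\<rho> \<noteq> 0"
    and "\<And>k. k \<ge> 1 \<Longrightarrow> poly (characteristic_poly k (lam k)) (1 / \<rho>) \<noteq> 0"
  shows "S_stable lam \<omega> \<and>
    (\<forall>k\<ge>1. \<forall>\<tau> :: 'a. norm \<tau> = 1 \<longrightarrow>
       (\<forall>j\<le>k. limiting_coeff (lam k) j =
                (-1) ^ j * of_real (norm (limiting_coeff (lam k) j)) / \<tau>) \<longrightarrow>
       of_real (limiting_stability_index k (lam k) \<omega>) =
         \<tau> * poly (characteristic_poly k (lam k)) (of_real (- 1 / norm \<rho>))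
           / of_real (norm (poly (characteristic_poly k (lam k)) (1 / \<rho>))))"
proof (intro conjI allI impI)
  note stab = stability_index_tendsto[OF assms(2) assms(3-5) assms(6)]
  show "S_stable lam \<omega>"
    unfolding S_stable_def
    using eventually_levin_denom_nonzero[OF assms(2) assms(3-5) assms(6)] convergentI[OF stab]
    by blast
  fix k :: nat and \<tau> :: 'a
  assume k: "k \<ge> 1" and "norm \<tau> = 1"
    and alt: "\<forall>j\<le>k. limiting_coeff (lam k) j =
                (-1) ^ j * of_real (norm (limiting_coeff (lam k) j)) / \<tau>"
  have "\<tau> \<noteq> 0" using \<open>norm \<tau> = 1\<close> by auto
  \<comment> \<open>The choice \<open>x = 1 / norm \<rho>\<close> turns the real sum into the
    numerator of the limit in \<open>stab\<close>.\<close>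
  from alternating_characteristic_poly[OF this, of k "lam k" "1 / norm \<rho>"] alt
  have num: "\<tau> * poly (characteristic_poly k (lam k)) (of_real (- 1 / norm \<rho>)) =
      of_real (\<Sum>j\<le>k. norm (limiting_coeff (lam k) j) * (1 / norm \<rho>) ^ j)"
    by simp
  show "of_real (limiting_stability_index k (lam k) \<omega>) =
         \<tau> * poly (characteristic_poly k (lam k)) (of_real (- 1 / norm \<rho>))
           / of_real (norm (poly (characteristic_poly k (lam k)) (1 / \<rho>)))"
    unfolding limiting_stability_index_def limI[OF stab[OF k k]] num by (rule of_real_divide)
qed

end
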